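(* Consider the Lagrange dual function $$\mathcal L(\mathbf p,\boldsymbol\lambda)=\sum_{k=1}^{K}\tilde R_k+\sum_{n=1}^{N}\lambda_n(p_n-p_{\max})-\sum_{n=1}^{N}\lambda_{n+N}\,p_n,$$ with $\mathbf p=[p_1,\dots,p_N]$ and $\boldsymbol\lambda=[\lambda_1,\dots,\lambda_{2N}]$. Its Jacobian $(J_m)_{1\le m\le 3N}$ (derivatives with respect to $p_1,\dots,p_N,\lambda_1,\dots,\lambda_{2N}$, in this order) is given by $$J_m=\frac{\partial\mathcal L(\mathbf p,\boldsymbol\lambda)}{\partial p_m}=\sum_{k=1}^{K}\frac{\partial\tilde R_k}{\partial p_m}+\lambda_m-\lambda_{m+N},\qquad 1\le m\le N,$$ $$J_m=\frac{\partial\mathcal L(\mathbf p,\boldsymbol\lambda)}{\partial\lambda_{m-N}}=\begin{cases}p_{m-N}-p_{\max}, & N+1\le m\le 2N,\\ -p_{m-2N}, & 2N+1\le m\le 3N.\end{cases}$$ Its Hessian $(G_{m,n})_{1\le m,n\le 3N}$ is given, for $1\le n\le N$, by $$G_{m,n}=\frac{\partial J_m}{\partial p_n}=\begin{cases}\displaystyle\sum_{k=1}^{K}\frac{\partial^2\tilde R_k}{\partial p_m\,\partial p_n}, & 1\le m\le N,\\ \delta(m-N,n), & N+1\le m\le 2N,\\ -\delta(m-2N,n), & 2N+1\le m\le 3N,\end{cases}$$ by $$G_{m,n}=\frac{\partial J_m}{\partial\lambda_{n-N}}=\delta(m,n-N)-\delta(m+N,n-N)$$ for $1\le m\le N$ and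 $N+1\le n\le 3N$, and by $G_{m,n}=0$ otherwise. Here $\delta(\cdot,\cdot)$ is the Kronecker delta.
   Context: A visible light communication network has $K$ users and $N$ LEDs. The following are fixed constants: channel gains $h_{kn}\ge 0$ (real) between user $k$ and LED $n$; photodetector responsivity $r>0$; noise spectral density $N_0>0$; bandwidth $B>0$; maximum power coefficient $p_{\max}>0$. A fixed LED assignment is given by $\alpha_{kn}\in\{0,1\}$, with $\alpha_{kn}=1$ if and only if LED $n$ serves user $k$. Each LED serves at most one user: $\sum_{k=1}^K\alpha_{kn}\le 1$ for all $n$. The variables are the power coefficients $\mathbf p=[p_1,\dots,p_N]$ with $0\le p_n\le p_{\max}$, and the real Lagrange multipliers $\boldsymbol\lambda=[\lambda_1,\dots,\lambda_{2N}]$. The signal-to-interference-plus-noise ratio of user $k$ and its rate are, as functions of $\mathbf p$, $$SINR(k)=\frac{\Bigl(\sum_{n=1}^{N}r\,\alpha_{kn}h_{kn}p_n\Bigr)^2}{N_0B+\sum_{j=1,\,j\ne k}^{K}\Bigl(\sum_{n=1}^{N}r\,\alpha_{jn}h_{kn}p_n\Bigr)^2},\qquad R_k=B\log_2\bigl(1+SINR(k)\bigr).$$ These formulas define smooth functions on all of $\mathbb R^N$, and partial derivatives are taken in that sense. The generic rate function $\tilde R_k$ is, for all $k$ simultaneously, either $R_k$ (sum-rate maximization) or $\log(R_k)$ with the natural logarithm (proportionally fair maximization); in the latter case points with $R_k>0$ for all $k$ are considered. *)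

theory Defs
  imports "HOL-Analysis.Analysis"
begin

text \<open>
  Vectors in \<open>\<real>\<^sup>d\<close> are functions \<open>nat \<Rightarrow> real\<close> of which only the
  entries at the indices \<open>1, \<dots>, d\<close> matter; users, LEDs and multipliers are likewise numbered from 1.
\<close>

definition pderivative :: "((nat \<Rightarrow> real) \<Rightarrow> real) \<Rightarrow> nat \<Rightarrow> (nat \<Rightarrow> real) \<Rightarrow> real" where
  "pderivative f i x = deriv (\<lambda>t. f (x(i := t))) (x i)"

text \<open>\<^const>\<open>deriv\<close> is unspecified where the derivative does not exist, so existence is a separate predicate.\<close>

definition pdifferentiable :: "((nat \<Rightarrow> real) \<Rightarrow> real) \<Rightarrow> nat \<Rightarrow> (nat \<Rightarrow> real) \<Rightarrow> bool" where
  "pdifferentiable f i x \<longleftrightarrow> (\<lambda>t. f (x(i := t))) differentiable (at (x i))"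

text \<open>\<open>\<partial>\<^sup>2f / \<partial>x\<^sub>i \<partial>x\<^sub>j = \<partial>/\<partial>x\<^sub>i (\<partial>f / \<partial>x\<^sub>j)\<close>: the variable written last is differentiated first.\<close>

definition pderivative2 :: "((nat \<Rightarrow> real) \<Rightarrow> real) \<Rightarrow> nat \<Rightarrow> nat \<Rightarrow> (nat \<Rightarrow> real) \<Rightarrow> real" where
  "pderivative2 f i j x = pderivative (pderivative f j) i x"

text \<open>
  Derivatives of a function of \<open>(p, l)\<close> with respect to the \<open>m\<close>-th entry of the combined list of variables
  \<open>p\<^sub>1, \<dots>, p\<^sub>N, l\<^sub>1, l\<^sub>2, \<dots>\<close>.
\<close>

definition joint_pderivative ::
  "nat \<Rightarrow> ((nat \<Rightarrow> real) \<Rightarrow> (nat \<Rightarrow> real) \<Rightarrow> real) \<Rightarrow> nat \<Rightarrow> (nat \<Rightarrow> real) \<Rightarrow> (nat \<Rightarrow> real) \<Rightarrow> real" where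
  "joint_pderivative N F m p l =
     (if m \<le> N then pderivative (\<lambda>q. F q l) m p else pderivative (\<lambda>u. F p u) (m - N) l)"

definition joint_pdifferentiable ::
  "nat \<Rightarrow> ((nat \<Rightarrow> real) \<Rightarrow> (nat \<Rightarrow> real) \<Rightarrow> real) \<Rightarrow> nat \<Rightarrow> (nat \<Rightarrow> real) \<Rightarrow> (nat \<Rightarrow> real) \<Rightarrow> bool" where
  "joint_pdifferentiable N F m p l \<longleftrightarrow>
     (if m \<le> N then pdifferentiable (\<lambda>q. F q l) m p else pdifferentiable (\<lambda>u. F p u) (m - N) l)"

definition kronecker :: "nat \<Rightarrow> nat \<Rightarrow> real" where
  "kronecker i j = (if i = j then 1 else 0)"

record vlc_network =
  users :: nat
  leds :: nat
  gain :: "nat \<Rightarrow> nat \<Rightarrow> real"  \<comment> \<open>user, LED\<close>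
  assign :: "nat \<Rightarrow> nat \<Rightarrow> real"  \<comment> \<open>user, LED\<close>
  responsivity :: real
  noise :: real
  bandwidth :: real
  pmax :: real

definition valid_network :: "vlc_network \<Rightarrow> bool" where
  "valid_network S \<longleftrightarrow>
     (\<forall>k\<in>{1..users S}. \<forall>n\<in>{1..leds S}. gain S k n \<ge> 0) \<and>
     (\<forall>k\<in>{1..users S}. \<forall>n\<in>{1..leds S}. assign S k n \<in> {0, 1}) \<and>
     (\<forall>n\<in>{1..leds S}. (\<Sum>k=1..users S. assign S k n) \<le> 1) \<and>
     responsivity S > 0 \<and> noise S > 0 \<and> bandwidth S > 0 \<and> pmax S > 0"

definition sinr :: "vlc_network \<Rightarrow> nat \<Rightarrow> (nat \<Rightarrow> real) \<Rightarrow> real" where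
  "sinr S k p =
     (\<Sum>n=1..leds S. responsivity S * assign S k n * gain S k n * p n)\<^sup>2 /
     (noise S * bandwidth S +
       (\<Sum>j\<in>{1..users S} - {k}. (\<Sum>n=1..leds S. responsivity S * assign S j n * gain S k n * p n)\<^sup>2))"

definition rate :: "vlc_network \<Rightarrow> nat \<Rightarrow> (nat \<Rightarrow> real) \<Rightarrow> real" where
  "rate S k p = bandwidth S * log 2 (1 + sinr S k p)"

datatype objective = Sum_Rate | Proportional_Fair

fun generic_rate :: "vlc_network \<Rightarrow> objective \<Rightarrow> nat \<Rightarrow> (nat \<Rightarrow> real) \<Rightarrow> real" where
  "generic_rate S Sum_Rate k p = rate S k p"
| "generic_rate S Proportional_Fair k p = ln (rate S k p)"

definition lagrangian ::
  "vlc_network \<Rightarrow> objective \<Rightarrow> (nat \<Rightarrow> real) \<Rightarrow> (nat \<Rightarrow> real) \<Rightarrow> real" where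
  "lagrangian S obj p l =
     (\<Sum>k=1..users S. generic_rate S obj k p)
     + (\<Sum>n=1..leds S. l n * (p n - pmax S))
     - (\<Sum>n=1..leds S. l (n + leds S) * p n)"

definition lagrangian_jacobian ::
  "vlc_network \<Rightarrow> objective \<Rightarrow> nat \<Rightarrow> (nat \<Rightarrow> real) \<Rightarrow> (nat \<Rightarrow> real) \<Rightarrow> real" where
  "lagrangian_jacobian S obj m = joint_pderivative (leds S) (lagrangian S obj) m"

definition lagrangian_hessian ::
  "vlc_network \<Rightarrow> objective \<Rightarrow> nat \<Rightarrow> nat \<Rightarrow> (nat \<Rightarrow> real) \<Rightarrow> (nat \<Rightarrow> real) \<Rightarrow> real" where
  "lagrangian_hessian S obj m n = joint_pderivative (leds S) (lagrangian_jacobian S obj m) n"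

end

theory Submission
  imports Defs
begin

text \<open>
  The multipliers enter the Lagrangian linearly, so the only entries with content are the
  \<open>p\<close>-\<open>p\<close> entries of the Hessian. There the entry at \<open>(m, n)\<close> differentiates first by \<open>p\<^sub>m\<close>, whereas
  \<^const>\<open>pderivative2\<close> at \<open>m n\<close> differentiates first by \<open>p\<^sub>n\<close>. That the two agree is not taken from
  Schwarz's theorem: the functions which have first partial derivatives and symmetric second ones
  are closed under products and under composition with univariate functions, and the rates are
  built by these operations.
\<close>

section \<open>Calculus of a single partial derivative\<close>

definition has_pderivative :: "((nat \<Rightarrow> real) \<Rightarrow> real) \<Rightarrow> nat \<Rightarrow> (nat \<Rightarrow> real) \<Rightarrow> real \<Rightarrow> bool" where
  "has_pderivative f i x D \<longleftrightarrow> ((\<lambda>t. f (x(i := t))) has_field_derivative D) (at (x i))"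

lemma has_pderivative_imp_pderivative: "has_pderivative f i x D \<Longrightarrow> pderivative f i x = D"
  by (simp add: has_pderivative_def pderivative_def DERIV_imp_deriv)

lemma has_pderivative_imp_pdifferentiable: "has_pderivative f i x D \<Longrightarrow> pdifferentiable f i x"
  unfolding has_pderivative_def pdifferentiable_def
  using real_differentiable_def by blast

lemma pdifferentiable_imp_has_pderivative:
  "pdifferentiable f i x \<Longrightarrow> has_pderivative f i x (pderivative f i x)"
  unfolding has_pderivative_def pdifferentiable_def pderivative_def
  by (metis DERIV_imp_deriv real_differentiable_def)

lemma has_pderivative_const: "has_pderivative (\<lambda>x. c) i x 0"
  by (simp add: has_pderivative_def)

lemma has_pderivative_coordinate: "has_pderivative (\<lambda>x. x n) i x (kronecker n i)"
  by (auto simp: has_pderivative_def kronecker_def)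

lemma has_pderivative_add:
  "has_pderivative f i x D \<Longrightarrow> has_pderivative g i x E \<Longrightarrow> has_pderivative (\<lambda>x. f x + g x) i x (D + E)"
  by (simp add: has_pderivative_def DERIV_add)

lemma has_pderivative_diff:
  "has_pderivative f i x D \<Longrightarrow> has_pderivative g i x E \<Longrightarrow> has_pderivative (\<lambda>x. f x - g x) i x (D - E)"
  by (simp add: has_pderivative_def DERIV_diff)

lemma has_pderivative_mult:
  assumes "has_pderivative f i x D" "has_pderivative g i x E"
  shows "has_pderivative (\<lambda>x. f x * g x) i x (D * g x + f x * E)"
  using DERIV_mult[OF assms[unfolded has_pderivative_def]]
  by (simp add: has_pderivative_def algebra_simps)

lemma has_pderivative_sum:
  assumes "\<And>k. k \<in> A \<Longrightarrow> has_pderivative (f k) i x (D k)"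
  shows "has_pderivative (\<lambda>x. \<Sum>k\<in>A. f k x) i x (\<Sum>k\<in>A. D k)"
  using assms unfolding has_pderivative_def by (intro DERIV_sum)

lemma has_pderivative_compose:
  assumes "(\<phi> has_field_derivative d) (at (f x))" "has_pderivative f i x D"
  shows "has_pderivative (\<lambda>x. \<phi> (f x)) i x (d * D)"
  using assms(2) unfolding has_pderivative_def
  by (intro DERIV_chain2[where g = "\<lambda>t. f (x(i := t))"]) (use assms(1) in auto)

text \<open>The filter is \<open>nhds\<close> and not \<open>at\<close>, because difference
  quotients also use the value at the point itself. This lets a formula for a partial derivative
  that is valid only on part of the space be differentiated once more.\<close>

lemma has_pderivative_cong_eventually:
  assumes "has_pderivative f i x D" "\<forall>\<^sub>F t in nhds (x i). g (x(i := t)) = f (x(i := t))"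
  shows "has_pderivative g i x D"
  using assms DERIV_cong_ev[OF refl assms(2) refl] by (simp add: has_pderivative_def)

section \<open>Functions with symmetric second partial derivatives\<close>

definition has_pderivatives2 ::
  "(nat \<Rightarrow> real) set \<Rightarrow> ((nat \<Rightarrow> real) \<Rightarrow> real) \<Rightarrow> (nat \<Rightarrow> (nat \<Rightarrow> real) \<Rightarrow> real)
    \<Rightarrow> (nat \<Rightarrow> nat \<Rightarrow> (nat \<Rightarrow> real) \<Rightarrow> real) \<Rightarrow> bool" where
  "has_pderivatives2 U f g H \<longleftrightarrow> (\<forall>x\<in>U. \<forall>i.
     has_pderivative f i x (g i x) \<and>
     (\<forall>j. has_pderivative (g i) j x (H i j x) \<and> H i j x = H j i x))"

text \<open>Gradient and Hessian are witnesses defined on the whole space rather than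
  \<open>pderivative\<close> terms. The derivative rules therefore apply to them at each point of an
  arbitrary \<open>U\<close>; a form of openness enters only when the witnesses are compared with
  \<open>pderivative\<close>.\<close>

definition twice_pdifferentiable :: "(nat \<Rightarrow> real) set \<Rightarrow> ((nat \<Rightarrow> real) \<Rightarrow> real) \<Rightarrow> bool" where
  "twice_pdifferentiable U f \<longleftrightarrow> (\<exists>g H. has_pderivatives2 U f g H)"

lemma twice_pdifferentiable_const: "twice_pdifferentiable U (\<lambda>x. c)"
proof -
  have "has_pderivatives2 U (\<lambda>x. c) (\<lambda>i x. 0) (\<lambda>i j x. 0)"
    by (simp add: has_pderivatives2_def has_pderivative_const)
  then show ?thesis unfolding twice_pdifferentiable_def by blast
qed

lemma twice_pdifferentiable_coordinate: "twice_pdifferentiable U (\<lambda>x. x n)"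
proof -
  have "has_pderivatives2 U (\<lambda>x. x n) (\<lambda>i x. kronecker n i) (\<lambda>i j x. 0)"
    by (simp add: has_pderivatives2_def has_pderivative_const has_pderivative_coordinate)
  then show ?thesis unfolding twice_pdifferentiable_def by blast
qed

lemma twice_pdifferentiable_add:
  assumes "twice_pdifferentiable U f" "twice_pdifferentiable U g"
  shows "twice_pdifferentiable U (\<lambda>x. f x + g x)"
proof -
  obtain f' f'' g' g'' where "has_pderivatives2 U f f' f''" "has_pderivatives2 U g g' g''"
    using assms unfolding twice_pdifferentiable_def by blast
  then have "has_pderivatives2 U (\<lambda>x. f x + g x) (\<lambda>i x. f' i x + g' i x) (\<lambda>i j x. f'' i j x + g'' i j x)"
    unfolding has_pderivatives2_def by (metis has_pderivative_add)
  then show ?thesis unfolding twice_pdifferentiable_def by blast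
qed

text \<open>Exchanging \<open>i\<close> and \<open>j\<close> exchanges the cross terms
  \<open>f' i x * g' j x\<close> and \<open>f' j x * g' i x\<close>; the two remaining terms inherit
  symmetry from the factors.\<close>

lemma twice_pdifferentiable_mult:
  assumes "twice_pdifferentiable U f" "twice_pdifferentiable U g"
  shows "twice_pdifferentiable U (\<lambda>x. f x * g x)"
proof -
  obtain f' f'' g' g'' where
    f: "has_pderivatives2 U f f' f''" and g: "has_pderivatives2 U g g' g''"
    using assms unfolding twice_pdifferentiable_def by blast
  have "has_pderivatives2 U (\<lambda>x. f x * g x) (\<lambda>i x. f' i x * g x + f x * g' i x)
     (\<lambda>i j x. (f'' i j x * g x + f' i x * g' j x) + (f' j x * g' i x + f x * g'' i j x))"
    unfolding has_pderivatives2_def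
  proof (intro ballI allI conjI)
    fix x i j assume x: "x \<in> U"
    note d = f[unfolded has_pderivatives2_def, rule_format, OF x]
      g[unfolded has_pderivatives2_def, rule_format, OF x]
    show "has_pderivative (\<lambda>x. f x * g x) i x (f' i x * g x + f x * g' i x)"
      by (intro has_pderivative_mult) (use d in auto)
    show "has_pderivative (\<lambda>x. f' i x * g x + f x * g' i x) j x
        ((f'' i j x * g x + f' i x * g' j x) + (f' j x * g' i x + f x * g'' i j x))"
      by (intro has_pderivative_add has_pderivative_mult) (use d in auto)
    have "f'' i j x = f'' j i x" "g'' i j x = g'' j i x"
      using d by blast+
    then show "(f'' i j x * g x + f' i x * g' j x) + (f' j x * g' i x + f x * g'' i j x) =
        (f'' j i x * g x + f' j x * g' i x) + (f' i x * g' j x + f x * g'' j i x)"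
      by simp
  qed
  then show ?thesis unfolding twice_pdifferentiable_def by blast
qed

lemma twice_pdifferentiable_sum:
  assumes "\<And>k. k \<in> A \<Longrightarrow> twice_pdifferentiable U (f k)"
  shows "twice_pdifferentiable U (\<lambda>x. \<Sum>k\<in>A. f k x)"
  using assms
  by (induction A rule: infinite_finite_induct)
     (auto intro: twice_pdifferentiable_const twice_pdifferentiable_add)

lemma twice_pdifferentiable_power2:
  "twice_pdifferentiable U f \<Longrightarrow> twice_pdifferentiable U (\<lambda>x. (f x)\<^sup>2)"
  unfolding power2_eq_square by (intro twice_pdifferentiable_mult)

text \<open>Both parts of the second derivative are symmetric: \<open>\<phi>''\<close> multiplies a
  product of two first partial derivatives, and \<open>\<phi>'\<close> multiplies the Hessian of
  \<open>f\<close>. The derivatives of \<open>\<phi>\<close> are required only at values taken on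
  \<open>U\<close>, which admits \<open>inverse\<close> and \<open>ln\<close>.\<close>

lemma twice_pdifferentiable_compose:
  assumes f: "twice_pdifferentiable U f"
    and \<phi>: "\<And>x. x \<in> U \<Longrightarrow> (\<phi> has_field_derivative \<phi>' (f x)) (at (f x))"
    and \<phi>': "\<And>x. x \<in> U \<Longrightarrow> (\<phi>' has_field_derivative \<phi>'' (f x)) (at (f x))"
  shows "twice_pdifferentiable U (\<lambda>x. \<phi> (f x))"
proof -
  obtain f' f'' where f: "has_pderivatives2 U f f' f''"
    using f unfolding twice_pdifferentiable_def by blast
  have "has_pderivatives2 U (\<lambda>x. \<phi> (f x)) (\<lambda>i x. \<phi>' (f x) * f' i x)
     (\<lambda>i j x. (\<phi>'' (f x) * f' j x) * f' i x + \<phi>' (f x) * f'' i j x)"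
    unfolding has_pderivatives2_def
  proof (intro ballI allI conjI)
    fix x i j assume x: "x \<in> U"
    note d = f[unfolded has_pderivatives2_def, rule_format, OF x]
    show "has_pderivative (\<lambda>x. \<phi> (f x)) i x (\<phi>' (f x) * f' i x)"
      by (intro has_pderivative_compose \<phi> x) (use d in auto)
    show "has_pderivative (\<lambda>x. \<phi>' (f x) * f' i x) j x
        ((\<phi>'' (f x) * f' j x) * f' i x + \<phi>' (f x) * f'' i j x)"
      by (intro has_pderivative_mult has_pderivative_compose \<phi>' x) (use d in auto)
    have "f'' i j x = f'' j i x"
      using d by blast
    then show "(\<phi>'' (f x) * f' j x) * f' i x + \<phi>' (f x) * f'' i j x =
        (\<phi>'' (f x) * f' i x) * f' j x + \<phi>' (f x) * f'' j i x"
      by simp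
  qed
  then show ?thesis unfolding twice_pdifferentiable_def by blast
qed

lemma twice_pdifferentiable_inverse:
  assumes "twice_pdifferentiable U f" "\<And>x. x \<in> U \<Longrightarrow> f x > 0"
  shows "twice_pdifferentiable U (\<lambda>x. inverse (f x))"
  using assms(1)
proof (rule twice_pdifferentiable_compose[where \<phi>' = "\<lambda>y. - inverse (y\<^sup>2)" and \<phi>'' = "\<lambda>y. 2 / y ^ 3"])
  fix x assume "x \<in> U"
  then have "f x \<noteq> 0" using assms(2) by force
  then show "(inverse has_field_derivative - inverse ((f x)\<^sup>2)) (at (f x))"
    "((\<lambda>y. - inverse (y\<^sup>2)) has_field_derivative 2 / f x ^ 3) (at (f x))"
    by (auto intro!: derivative_eq_intros simp: field_simps power2_eq_square power3_eq_cube)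
qed

lemma twice_pdifferentiable_ln:
  assumes "twice_pdifferentiable U f" "\<And>x. x \<in> U \<Longrightarrow> f x > 0"
  shows "twice_pdifferentiable U (\<lambda>x. ln (f x))"
  using assms(1)
proof (rule twice_pdifferentiable_compose[where \<phi>' = "\<lambda>y. inverse y" and \<phi>'' = "\<lambda>y. - inverse (y\<^sup>2)"])
  fix x assume "x \<in> U"
  then have "f x > 0" using assms(2) by force
  then show "(ln has_field_derivative inverse (f x)) (at (f x))"
    "(inverse has_field_derivative - inverse ((f x)\<^sup>2)) (at (f x))"
    by (auto intro!: derivative_eq_intros simp: field_simps power2_eq_square)
qed

section \<open>Sets that are open along coordinate lines\<close>

definition line_open :: "(nat \<Rightarrow> real) set \<Rightarrow> bool" where
  "line_open U \<longleftrightarrow> (\<forall>x\<in>U. \<forall>i. \<forall>\<^sub>F t in nhds (x i). x(i := t) \<in> U)"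

text \<open>Partial derivatives see only the coordinate lines through a point, so openness along
  these lines suffices. A partially differentiable function is continuous along each of them and
  hence stays positive near the point; finitely many such conditions hold together.\<close>

lemma line_open_positive:
  assumes "finite A" and f: "\<And>k. k \<in> A \<Longrightarrow> twice_pdifferentiable UNIV (f k)"
  shows "line_open {x. \<forall>k\<in>A. f k x > 0}"
  unfolding line_open_def
proof (intro ballI allI)
  fix x i assume x: "x \<in> {x. \<forall>k\<in>A. f k x > 0}"
  have "\<forall>\<^sub>F t in nhds (x i). f k (x(i := t)) > 0" if "k \<in> A" for k
  proof -
    have "isCont (\<lambda>t. f k (x(i := t))) (x i)"
      using f[OF that] DERIV_isCont
      unfolding twice_pdifferentiable_def has_pderivatives2_def has_pderivative_def by blast
    \<comment> \<open>\<open>isCont\<close> speaks of a punctured neighbourhood, whereas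
      \<open>line_open\<close> includes the point itself.\<close>
    then have "((\<lambda>t. f k (x(i := t))) \<longlongrightarrow> f k x) (nhds (x i))"
      using tendsto_at_iff_tendsto_nhds[of "\<lambda>t. f k (x(i := t))" "x i"] by (simp add: isCont_def)
    then show ?thesis using x that by (intro order_tendstoD(1)) auto
  qed
  then show "\<forall>\<^sub>F t in nhds (x i). x(i := t) \<in> {x. \<forall>k\<in>A. f k x > 0}"
    using \<open>finite A\<close> by (simp add: eventually_ball_finite_distrib)
qed

text \<open>On \<open>U\<close> the witness \<open>g i\<close> is \<open>pderivative f i\<close>.
  Since \<open>U\<close> is line-open, they agree near \<open>x\<close> on each coordinate line, so
  their derivatives at \<open>x\<close> agree too, and the symmetry of \<open>H\<close> passes to
  \<open>pderivative2\<close>.\<close>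

lemma twice_pdifferentiable_imp:
  assumes f: "twice_pdifferentiable U f" and U: "line_open U" and x: "x \<in> U"
  shows twice_pdifferentiable_imp_pdifferentiable: "pdifferentiable f i x"
    and twice_pdifferentiable_imp_pdifferentiable_pderivative: "pdifferentiable (pderivative f i) j x"
    and twice_pdifferentiable_imp_symmetric: "pderivative2 f i j x = pderivative2 f j i x"
proof -
  obtain g H where gH: "has_pderivatives2 U f g H"
    using f unfolding twice_pdifferentiable_def by blast
  have g: "has_pderivative f i y (g i y)" if "y \<in> U" for i y
    using gH that unfolding has_pderivatives2_def by blast
  show "pdifferentiable f i x"
    using g[OF x] by (rule has_pderivative_imp_pdifferentiable)
  have H: "has_pderivative (pderivative f i) j x (H i j x)" for i j
  proof (rule has_pderivative_cong_eventually)
    show "has_pderivative (g i) j x (H i j x)"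
      using gH x unfolding has_pderivatives2_def by blast
    have "\<forall>\<^sub>F t in nhds (x j). x(j := t) \<in> U"
      using U x unfolding line_open_def by blast
    then show "\<forall>\<^sub>F t in nhds (x j). pderivative f i (x(j := t)) = g i (x(j := t))"
      by eventually_elim (intro has_pderivative_imp_pderivative g)
  qed
  show "pdifferentiable (pderivative f i) j x"
    using H by (rule has_pderivative_imp_pdifferentiable)
  have "H i j x = H j i x"
    using gH x unfolding has_pderivatives2_def by blast
  \<comment> \<open>\<open>H i j x\<close> differentiates by \<open>i\<close> first and
    \<open>pderivative2 f i j x\<close> by \<open>j\<close> first, so the latter is
    \<open>H j i x\<close>.\<close>
  then show "pderivative2 f i j x = pderivative2 f j i x"
    using H[THEN has_pderivative_imp_pderivative] by (simp add: pderivative2_def)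
qed

section \<open>Differentiability of the SINR and the rates\<close>

lemma sinr_nonneg: "valid_network S \<Longrightarrow> sinr S k x \<ge> 0"
  unfolding sinr_def valid_network_def by (simp add: sum_nonneg add_nonneg_nonneg)

text \<open>The denominator is a positive constant plus squares, hence positive at every point, so
  \<open>U\<close> is arbitrary.\<close>

lemma twice_pdifferentiable_sinr:
  assumes "valid_network S"
  shows "twice_pdifferentiable U (sinr S k)"
proof -
  have "noise S * bandwidth S > 0"
    using assms by (simp add: valid_network_def)
  then show ?thesis
    unfolding sinr_def[abs_def] divide_inverse
    by (intro twice_pdifferentiable_mult twice_pdifferentiable_inverse twice_pdifferentiable_add
        twice_pdifferentiable_const twice_pdifferentiable_power2 twice_pdifferentiable_sum
        twice_pdifferentiable_coordinate add_pos_nonneg sum_nonneg zero_le_power2)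
qed

text \<open>The argument of the logarithm is at least 1, and the logarithm to base 2 is a constant
  multiple of \<open>ln\<close>. The case of \<open>UNIV\<close> serves to show that the domain of
  the logarithmic objective is line-open.\<close>

lemma twice_pdifferentiable_rate:
  assumes "valid_network S"
  shows "twice_pdifferentiable U (rate S k)"
  unfolding rate_def[abs_def] log_def divide_inverse
  by (intro twice_pdifferentiable_mult twice_pdifferentiable_ln twice_pdifferentiable_add
      twice_pdifferentiable_const twice_pdifferentiable_sinr assms add_pos_nonneg sinr_nonneg) simp

text \<open>The box of admissible powers is not imposed: a point on its boundary leaves it under
  small changes of one coordinate, so the box is not line-open, and the partial derivatives there
  are two-sided.\<close>

definition objective_domain :: "vlc_network \<Rightarrow> objective \<Rightarrow> (nat \<Rightarrow> real) set" where
  "objective_domain S obj = {x. obj = Proportional_Fair \<longrightarrow> (\<forall>k\<in>{1..users S}. rate S k x > 0)}"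

lemma line_open_objective_domain:
  assumes "valid_network S"
  shows "line_open (objective_domain S obj)"
proof (cases obj)
  case Sum_Rate
  then show ?thesis by (simp add: objective_domain_def line_open_def)
next
  case Proportional_Fair
  then show ?thesis
    using line_open_positive[of "{1..users S}" "rate S"] twice_pdifferentiable_rate[OF assms]
    by (simp add: objective_domain_def)
qed

lemma twice_pdifferentiable_generic_rate:
  assumes "valid_network S" "k \<in> {1..users S}"
  shows "twice_pdifferentiable (objective_domain S obj) (generic_rate S obj k)"
proof (cases obj)
  case Sum_Rate
  have "generic_rate S Sum_Rate k = rate S k" by auto
  then show ?thesis using Sum_Rate assms by (simp add: twice_pdifferentiable_rate)
next
  case Proportional_Fair
  have "generic_rate S Proportional_Fair k = (\<lambda>x. ln (rate S k x))" by auto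
  moreover have "rate S k x > 0" if "x \<in> objective_domain S Proportional_Fair" for x
    using that assms(2) by (simp add: objective_domain_def)
  ultimately show ?thesis
    using Proportional_Fair assms by (simp add: twice_pdifferentiable_ln twice_pdifferentiable_rate)
qed

section \<open>First derivatives of the Lagrangian\<close>

lemma sum_kronecker:
  assumes "finite A"
  shows "(\<Sum>n\<in>A. kronecker n i * c n) = (if i \<in> A then c i else 0)"
  using assms by (simp add: kronecker_def if_distrib[of "\<lambda>z. z * _"] cong: if_cong)

lemma has_pderivative_lagrangian_power:
  assumes S: "valid_network S" and x: "x \<in> objective_domain S obj" and m: "m \<in> {1..leds S}"
  shows "has_pderivative (\<lambda>q. lagrangian S obj q l) m x
    ((\<Sum>k=1..users S. pderivative (generic_rate S obj k) m x) + l m - l (m + leds S))"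
proof -
  note d = twice_pdifferentiable_imp_pdifferentiable
    [OF twice_pdifferentiable_generic_rate[OF S] line_open_objective_domain[OF S] x]
  \<comment> \<open>The value is left in the raw form that the sum and product rules produce, so
    that they apply by unification; the Kronecker sums then collapse to \<open>l m\<close> and
    \<open>l (m + leds S)\<close>.\<close>
  have "has_pderivative (\<lambda>q. lagrangian S obj q l) m x
    ((\<Sum>k=1..users S. pderivative (generic_rate S obj k) m x)
      + (\<Sum>n=1..leds S. 0 * (x n - pmax S) + l n * (kronecker n m - 0))
      - (\<Sum>n=1..leds S. 0 * x n + l (n + leds S) * kronecker n m))"
    unfolding lagrangian_def
    by (intro has_pderivative_add has_pderivative_diff has_pderivative_sum has_pderivative_mult
        has_pderivative_const has_pderivative_coordinate pdifferentiable_imp_has_pderivative d)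
  then show ?thesis
    using m sum_kronecker[of "{1..leds S}" m l]
      sum_kronecker[of "{1..leds S}" m "\<lambda>n. l (n + leds S)"]
    by (simp add: mult.commute)
qed

lemma has_pderivative_lagrangian_multiplier:
  assumes i: "i \<in> {1..2 * leds S}"
  shows "has_pderivative (\<lambda>u. lagrangian S obj p u) i l
    (if i \<le> leds S then p i - pmax S else - p (i - leds S))"
proof -
  have d: "has_pderivative (\<lambda>u. lagrangian S obj p u) i l
    (0 + (\<Sum>n=1..leds S. kronecker n i * (p n - pmax S) + l n * 0)
      - (\<Sum>n=1..leds S. kronecker (n + leds S) i * p n + l (n + leds S) * 0))"
    unfolding lagrangian_def
    by (intro has_pderivative_add has_pderivative_diff has_pderivative_sum has_pderivative_mult
        has_pderivative_const has_pderivative_coordinate)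
  \<comment> \<open>As \<open>n\<close> is at least 1, \<open>n + leds S\<close> exceeds
    \<open>leds S\<close>; hence the first half of the multipliers does not occur in this
    sum.\<close>
  have shift: "kronecker (n + leds S) i =
      (if leds S < i then kronecker n (i - leds S) else 0)" if "n \<in> {1..leds S}" for n
    using that by (auto simp: kronecker_def)
  have "(\<Sum>n=1..leds S. kronecker (n + leds S) i * p n) =
      (if leds S < i then \<Sum>n=1..leds S. kronecker n (i - leds S) * p n else 0)"
    using shift by (auto intro!: sum.cong sum.neutral)
  then show ?thesis
    using d i sum_kronecker[of "{1..leds S}" i "\<lambda>n. p n - pmax S"]
      sum_kronecker[of "{1..leds S}" "i - leds S" p]
    by (auto split: if_splits)
qed

section \<open>Entries of the Jacobian and their derivatives\<close>

lemma lagrangian_jacobian_power: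
  assumes "valid_network S" "x \<in> objective_domain S obj" "m \<in> {1..leds S}"
  shows "lagrangian_jacobian S obj m x l =
    (\<Sum>k=1..users S. pderivative (generic_rate S obj k) m x) + l m - l (m + leds S)"
  using has_pderivative_imp_pderivative[OF has_pderivative_lagrangian_power[OF assms]] assms(3)
  by (simp add: lagrangian_jacobian_def joint_pderivative_def)

text \<open>The rates are constant in the multipliers, so this formula holds at every
  \<open>x\<close>, inside the domain of the objective or not.\<close>

lemma lagrangian_jacobian_multiplier:
  assumes "m \<in> {leds S<..3 * leds S}"
  shows "lagrangian_jacobian S obj m x l =
    (if m \<le> 2 * leds S then x (m - leds S) - pmax S else - x (m - 2 * leds S))"
proof -
  have "m - leds S \<in> {1..2 * leds S}" "m - leds S - leds S = m - 2 * leds S"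
    using assms by auto
  then show ?thesis
    using assms has_pderivative_imp_pderivative[OF has_pderivative_lagrangian_multiplier, of "m - leds S" S obj x l]
    by (auto simp: lagrangian_jacobian_def joint_pderivative_def)
qed

text \<open>Differentiating entry \<open>m\<close> of the Jacobian by the \<open>n\<close>-th power
  gives \<open>pderivative2\<close> at \<open>n m\<close>; symmetry turns this into
  \<open>m n\<close>. No other block of the Hessian uses symmetry.\<close>

lemma has_pderivative_lagrangian_jacobian_power_power:
  assumes S: "valid_network S" and x: "x \<in> objective_domain S obj"
    and m: "m \<in> {1..leds S}"
  shows "has_pderivative (\<lambda>q. lagrangian_jacobian S obj m q l) n x
    (\<Sum>k=1..users S. pderivative2 (generic_rate S obj k) m n x)"
proof -
  let ?J = "\<lambda>q. (\<Sum>k=1..users S. pderivative (generic_rate S obj k) m q) + l m - l (m + leds S)"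
  note t = twice_pdifferentiable_generic_rate[OF S, of _ obj]
    and U = line_open_objective_domain[OF S, of obj]
  have "has_pderivative (pderivative (generic_rate S obj k) m) n x
      (pderivative2 (generic_rate S obj k) m n x)" if "k \<in> {1..users S}" for k
    using pdifferentiable_imp_has_pderivative
        [OF twice_pdifferentiable_imp_pdifferentiable_pderivative[OF t[OF that] U x]]
      twice_pdifferentiable_imp_symmetric[OF t[OF that] U x]
    by (metis pderivative2_def)
  then have "has_pderivative ?J n x
      ((\<Sum>k=1..users S. pderivative2 (generic_rate S obj k) m n x) + 0 - 0)"
    by (intro has_pderivative_add has_pderivative_diff has_pderivative_const has_pderivative_sum)
  \<comment> \<open>The formula for the Jacobian is available only on
    \<open>objective_domain\<close>, hence only for \<open>t\<close> near
    \<open>x n\<close>.\<close>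
  moreover have "\<forall>\<^sub>F t in nhds (x n). lagrangian_jacobian S obj m (x(n := t)) l = ?J (x(n := t))"
  proof -
    have "\<forall>\<^sub>F t in nhds (x n). x(n := t) \<in> objective_domain S obj"
      using U x unfolding line_open_def by blast
    then show ?thesis
      by eventually_elim (rule lagrangian_jacobian_power[OF S _ m])
  qed
  ultimately show ?thesis
    using has_pderivative_cong_eventually by fastforce
qed

text \<open>Only the multipliers vary and \<open>x\<close> stays in the domain, so the formula for
  the Jacobian can be rewritten for all \<open>u\<close> at once.\<close>

lemma has_pderivative_lagrangian_jacobian_power_multiplier:
  assumes "valid_network S" "x \<in> objective_domain S obj" "m \<in> {1..leds S}"
  shows "has_pderivative (\<lambda>u. lagrangian_jacobian S obj m x u) i l
    (kronecker m i - kronecker (m + leds S) i)"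
proof -
  have "has_pderivative (\<lambda>u. (\<Sum>k=1..users S. pderivative (generic_rate S obj k) m x) + u m - u (m + leds S))
      i l (0 + kronecker m i - kronecker (m + leds S) i)"
    by (intro has_pderivative_add has_pderivative_diff has_pderivative_const has_pderivative_coordinate)
  then show ?thesis by (simp add: lagrangian_jacobian_power[OF assms])
qed

lemma has_pderivative_lagrangian_jacobian_multiplier_power:
  assumes "m \<in> {leds S<..3 * leds S}"
  shows "has_pderivative (\<lambda>q. lagrangian_jacobian S obj m q l) n x
    (if m \<le> 2 * leds S then kronecker (m - leds S) n else - kronecker (m - 2 * leds S) n)"
proof -
  have "has_pderivative (\<lambda>q. q (m - leds S) - pmax S) n x (kronecker (m - leds S) n - 0)"
    \<comment> \<open>The negation is written as a difference from 0 so that the difference rule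
      covers it.\<close>
    "has_pderivative (\<lambda>q. 0 - q (m - 2 * leds S)) n x (0 - kronecker (m - 2 * leds S) n)"
    by (intro has_pderivative_diff has_pderivative_const has_pderivative_coordinate)+
  then show ?thesis by (simp add: lagrangian_jacobian_multiplier[OF assms])
qed

lemma has_pderivative_lagrangian_jacobian_multiplier_multiplier:
  assumes "m \<in> {leds S<..3 * leds S}"
  shows "has_pderivative (\<lambda>u. lagrangian_jacobian S obj m x u) i l 0"
  by (simp add: lagrangian_jacobian_multiplier[OF assms] has_pderivative_const)

theorem corollary1:
  fixes S :: vlc_network and obj :: objective and N :: nat and p l :: "nat \<Rightarrow> real"
  assumes "valid_network S" and "N = leds S"
    and "\<forall>n\<in>{1..N}. 0 \<le> p n \<and> p n \<le> pmax S"
    and "obj = Proportional_Fair \<longrightarrow> (\<forall>k\<in>{1..users S}. rate S k p > 0)"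
  shows "(\<forall>k\<in>{1..users S}. \<forall>m\<in>{1..N}. pdifferentiable (generic_rate S obj k) m p)
    \<and> (\<forall>k\<in>{1..users S}. \<forall>m\<in>{1..N}. \<forall>n\<in>{1..N}.
          pdifferentiable (pderivative (generic_rate S obj k) n) m p)
    \<and> (\<forall>m\<in>{1..3*N}. joint_pdifferentiable N (lagrangian S obj) m p l)
    \<and> (\<forall>m\<in>{1..3*N}. \<forall>n\<in>{1..3*N}. joint_pdifferentiable N (lagrangian_jacobian S obj m) n p l)
    \<and> (\<forall>m\<in>{1..3*N}. lagrangian_jacobian S obj m p l =
          (if m \<le> N then
             (\<Sum>k=1..users S. pderivative (generic_rate S obj k) m p) + l m - l (m + N)
           else if m \<le> 2*N then p (m - N) - pmax S
           else - p (m - 2*N)))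
    \<and> (\<forall>m\<in>{1..3*N}. \<forall>n\<in>{1..3*N}. lagrangian_hessian S obj m n p l =
          (if n \<le> N then
             (if m \<le> N then \<Sum>k=1..users S. pderivative2 (generic_rate S obj k) m n p
              else if m \<le> 2*N then kronecker (m - N) n
              else - kronecker (m - 2*N) n)
           else if m \<le> N then kronecker m (n - N) - kronecker (m + N) (n - N)
           else 0))"
proof -
  note S = assms(1) and N = assms(2)
  have p: "p \<in> objective_domain S obj"
    using assms(4) by (simp add: objective_domain_def)
  note rates = twice_pdifferentiable_generic_rate[OF S, of _ obj]
    line_open_objective_domain[OF S, of obj] p
  have gradient: "joint_pdifferentiable N (lagrangian S obj) m p l" if "m \<in> {1..3*N}" for m
  proof (cases "m \<le> N")
    case True
    then show ?thesis
      using that has_pderivative_lagrangian_power[OF S p, of m l] N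
      by (auto simp: joint_pdifferentiable_def intro: has_pderivative_imp_pdifferentiable)
  next
    case False
    then have "m - N \<in> {1..2 * leds S}" using that N by auto
    from has_pderivative_lagrangian_multiplier[OF this] False show ?thesis
      by (auto simp: joint_pdifferentiable_def intro: has_pderivative_imp_pdifferentiable)
  qed
  have hessian: "joint_pdifferentiable N (lagrangian_jacobian S obj m) n p l \<and>
      lagrangian_hessian S obj m n p l =
        (if n \<le> N then
           (if m \<le> N then \<Sum>k=1..users S. pderivative2 (generic_rate S obj k) m n p
            else if m \<le> 2*N then kronecker (m - N) n
            else - kronecker (m - 2*N) n)
         else if m \<le> N then kronecker m (n - N) - kronecker (m + N) (n - N)
         else 0)"
    if m: "m \<in> {1..3*N}" for m n
  proof (cases "m \<le> N")
    case True
    then have "m \<in> {1..leds S}" using m N by simp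
    \<comment> \<open>Both facts hold for every \<open>n\<close>, with truncated
      \<open>n - N\<close>; the case distinction in \<open>joint_pderivative\<close> selects the
      relevant one.\<close>
    note d = has_pderivative_lagrangian_jacobian_power_power[OF S p this, of l n]
      has_pderivative_lagrangian_jacobian_power_multiplier[OF S p this, of "n - N" l]
    show ?thesis
      using True N d[THEN has_pderivative_imp_pderivative] d[THEN has_pderivative_imp_pdifferentiable]
      by (simp add: joint_pdifferentiable_def lagrangian_hessian_def joint_pderivative_def)
  next
    case False
    then have "m \<in> {leds S<..3 * leds S}" using m N by simp
    note d = has_pderivative_lagrangian_jacobian_multiplier_power[OF this, of obj l n p]
      has_pderivative_lagrangian_jacobian_multiplier_multiplier[OF this, of obj p "n - N" l]
    show ?thesis
      using False N d[THEN has_pderivative_imp_pderivative] d[THEN has_pderivative_imp_pdifferentiable]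
      by (simp add: joint_pdifferentiable_def lagrangian_hessian_def joint_pderivative_def)
  qed
  have jacobian: "lagrangian_jacobian S obj m p l =
      (if m \<le> N then
         (\<Sum>k=1..users S. pderivative (generic_rate S obj k) m p) + l m - l (m + N)
       else if m \<le> 2*N then p (m - N) - pmax S
       else - p (m - 2*N))" if "m \<in> {1..3*N}" for m
    using that N lagrangian_jacobian_power[OF S p, of m l] lagrangian_jacobian_multiplier[of m S obj p l]
    by auto
  show ?thesis
    by (intro conjI ballI gradient jacobian hessian[THEN conjunct1] hessian[THEN conjunct2]
        twice_pdifferentiable_imp_pdifferentiable[OF rates]
        twice_pdifferentiable_imp_pdifferentiable_pderivative[OF rates])
qed

end
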